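(* Let $\mathcal I$ be an ideal on $\mathbb N$. Let $g:(0,\infty)\to(0,\infty)$ be a strictly increasing function such that $\lim_{x\to 0^+} g(x)=0$ and $$\forall \varepsilon>0\ \exists M\ \forall x>0\ \left(\frac{g(x)}{g(\varepsilon x)}\leq M\right).$$ Let $(b_n)_{n\in\mathbb N}$ and $(c_n)_{n\in\mathbb N}$ be sequences of positive reals. Then the following conditions are equivalent. (1) For every sequence $(a_n)_{n\in\mathbb N}$ with $a_n\in\mathrm{ran}(g)$ for all $n$: if $\sum_{n=1}^{\infty} b_n a_n<\infty$ then $\mathcal I^*\text{-}\lim c_n g^{-1}(a_n)=0$. (2) For every sequence $(a_n)_{n\in\mathbb N}$ with $a_n\in\mathrm{ran}(g)$ for all $n$: if $\sum_{n=1}^{\infty} b_n a_n<\infty$ then $\mathcal I\text{-}\lim c_n g^{-1}(a_n)=0$. (3) $\mathcal I_{(b_n g(1/c_n))}\subseteq \mathcal I$.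
   Context: $\mathbb N=\{1,2,\dots\}$. An ideal on $\mathbb N$ is a nonempty family $\mathcal I\subseteq\mathcal P(\mathbb N)$ closed under subsets and finite unions, containing all finite subsets of $\mathbb N$, with $\mathbb N\notin\mathcal I$. $\mathcal I^*=\{\mathbb N\setminus A: A\in\mathcal I\}$ is the dual filter. For a real sequence $(x_n)$: $\mathcal I\text{-}\lim x_n=L$ means $\{n\in\mathbb N:|x_n-L|\ge\varepsilon\}\in\mathcal I$ for every $\varepsilon>0$; $\mathcal I^*\text{-}\lim x_n=L$ means there is $F\in\mathcal I^*$ such that the subsequence $(x_n)_{n\in F}$ converges to $L$ in the ordinary sense. For a sequence $(d_n)$ of nonnegative reals, $\mathcal I_{(d_n)}=\{A\subseteq\mathbb N:\sum_{n\in A}d_n<\infty\}$. $\mathrm{ran}(g)$ is the range of $g$, and $g^{-1}:\mathrm{ran}(g)\to(0,\infty)$ is the inverse of the injective function $g$. *)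

theory Defs
  imports "HOL-Analysis.Analysis"
begin

text \<open>
  Here \<open>\<nat> = {1, 2, \<dots>}\<close>. Families of subsets of \<open>\<nat>\<close> are sets of subsets of \<open>posnats\<close>;
  a sequence is a function on the type \<open>nat\<close> whose value at \<open>0\<close> is irrelevant.
\<close>

abbreviation posnats :: "nat set" where
  "posnats \<equiv> {1..}"

definition ideal_on_posnats :: "nat set set \<Rightarrow> bool" where
  "ideal_on_posnats I \<longleftrightarrow>
     I \<noteq> {} \<and> I \<subseteq> Pow posnats \<and>
     (\<forall>A\<in>I. \<forall>B. B \<subseteq> A \<longrightarrow> B \<in> I) \<and>
     (\<forall>A\<in>I. \<forall>B\<in>I. A \<union> B \<in> I) \<and>
     (\<forall>A. A \<subseteq> posnats \<and> finite A \<longrightarrow> A \<in> I) \<and>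
     posnats \<notin> I"

definition dual_filter :: "nat set set \<Rightarrow> nat set set" where
  "dual_filter I = {posnats - A | A. A \<in> I}"

definition ideal_lim :: "nat set set \<Rightarrow> (nat \<Rightarrow> real) \<Rightarrow> real \<Rightarrow> bool" where
  "ideal_lim I x L \<longleftrightarrow> (\<forall>\<epsilon>>0. {n \<in> posnats. \<bar>x n - L\<bar> \<ge> \<epsilon>} \<in> I)"

text \<open>
  \<open>enumerate F\<close> lists the elements of \<open>F\<close> in increasing order. This presupposes that \<open>F\<close> is
  infinite, which holds for every member of the dual filter of an ideal in the above sense.
\<close>

definition ideal_star_lim :: "nat set set \<Rightarrow> (nat \<Rightarrow> real) \<Rightarrow> real \<Rightarrow> bool" where
  "ideal_star_lim I x L \<longleftrightarrow> (\<exists>F\<in>dual_filter I. (\<lambda>k. x (enumerate F k)) \<longlonglongrightarrow> L)"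

text \<open>For nonnegative terms, \<open>summable_on\<close> says that the sum over \<open>A\<close> is finite.\<close>

definition summable_ideal :: "(nat \<Rightarrow> real) \<Rightarrow> nat set set" where
  "summable_ideal d = {A. A \<subseteq> posnats \<and> d summable_on A}"

end

theory Submission
  imports Defs
begin

text \<open>
  The key step is (3) \<open>\<Longrightarrow>\<close> (1). Let \<open>y\<^sub>n = c\<^sub>n g\<^sup>-\<^sup>1(a\<^sub>n)\<close>, so that \<open>a\<^sub>n = g(y\<^sub>n / c\<^sub>n)\<close>. A convergent series
  \<open>\<Sum> b\<^sub>n a\<^sub>n\<close> with positive terms stays convergent after multiplication by the
  weights \<open>t\<^sub>n = 1 / \<surd>r\<^sub>n \<longlonglongrightarrow> \<infinity>\<close>, where \<open>r\<^sub>n\<close> is its \<open>n\<close>-th tail, because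
  \<open>(r\<^sub>n - r\<^sub>n\<^sub>+\<^sub>1) / \<surd>r\<^sub>n \<le> 2 (\<surd>r\<^sub>n - \<surd>r\<^sub>n\<^sub>+\<^sub>1)\<close> telescopes. The set \<open>A\<close> of those \<open>n\<close> with \<open>b\<^sub>n g(1/c\<^sub>n) \<le> t\<^sub>n b\<^sub>n a\<^sub>n\<close> then lies in the
  summable ideal, hence in \<open>I\<close>. Off \<open>A\<close> we have \<open>t\<^sub>n < g(1/c\<^sub>n) / g(y\<^sub>n/c\<^sub>n)\<close>, and if \<open>y\<^sub>n \<ge> \<epsilon>\<close> the
  right-hand side is bounded by a constant depending on \<open>\<epsilon>\<close> only, so this happens finitely often.
  For (2) \<open>\<Longrightarrow>\<close> (3), take \<open>a\<^sub>n = g(1/c\<^sub>n)\<close> on a given member of the summable ideal and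
  \<open>a\<^sub>n\<close> so small that \<open>b\<^sub>n a\<^sub>n \<le> 2\<^sup>-\<^sup>n\<close> elsewhere.
\<close>

lemma summable_diverging_weights:
  fixes p :: "nat \<Rightarrow> real"
  assumes pos: "\<And>n. p n > 0" and sm: "summable p"
  obtains t where "\<And>n. t n > 0" "filterlim t at_top sequentially" "summable (\<lambda>n. t n * p n)"
proof -
  define r where "r n = (\<Sum>k. p (k + n))" for n
  have sm': "summable (\<lambda>k. p (k + n))" for n
    using sm by (rule summable_ignore_initial_segment)
  have rpos: "r n > 0" for n
    unfolding r_def by (rule suminf_pos[OF sm']) (rule pos)
  have rSuc: "r n = p n + r (Suc n)" for n
    using suminf_split_head[OF sm'[of n]] by (simp add: r_def)
  have r0: "r \<longlonglongrightarrow> 0"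
    unfolding r_def by (rule suminf_exist_split2[OF sm])
  have sr0: "(\<lambda>n. sqrt (r n)) \<longlonglongrightarrow> 0"
    using tendsto_real_sqrt[OF r0] by simp
  define t where "t n = inverse (sqrt (r n))" for n
  have ttop: "filterlim t at_top sequentially"
    unfolding t_def using sr0 by (rule filterlim_inverse_at_top) (simp add: rpos)
  have le: "t n * p n \<le> 2 * (sqrt (r n) - sqrt (r (Suc n)))" for n
  proof -
    let ?u = "sqrt (r n)" and ?v = "sqrt (r (Suc n))"
    \<comment> \<open>\<open>p n = r n - r (Suc n)\<close> is a difference of squares, and
      \<open>?v \<le> ?u\<close> bounds the second factor by \<open>2 * ?u\<close>, which the weight
      \<open>t n = 1 / ?u\<close> then cancels.\<close>
    have "p n = (?u - ?v) * (?u + ?v)"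
      using rSuc[of n] rpos[of n] rpos[of "Suc n"] by (simp add: algebra_simps)
    moreover have "?v \<le> ?u"
      using rSuc[of n] pos[of n] by simp
    then have "(?u - ?v) * (?u + ?v) \<le> (?u - ?v) * (2 * ?u)"
      by (intro mult_left_mono) auto
    ultimately have "p n \<le> 2 * (?u - ?v) * ?u" by (simp add: algebra_simps)
    then show ?thesis
      using rpos[of n] by (simp add: t_def field_simps)
  qed
  have tele: "summable (\<lambda>n. 2 * (sqrt (r n) - sqrt (r (Suc n))))"
    using telescope_summable'[OF sr0] by (rule summable_mult)
  have tpos: "t n > 0" for n
    by (simp add: t_def rpos)
  have "norm (t n * p n) \<le> 2 * (sqrt (r n) - sqrt (r (Suc n)))" for n
    using le[of n] tpos[of n] pos[of n] by simp
  then have "summable (\<lambda>n. t n * p n)"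
    by (rule summable_comparison_test'[OF tele])
  with tpos ttop show thesis by (rule that)
qed

text \<open>For nonnegative terms unordered summability and convergence of the series agree; the
  shift by \<open>Suc\<close> passes over the irrelevant value at \<open>0\<close>.\<close>

lemma summable_on_posnats_iff:
  fixes f :: "nat \<Rightarrow> real"
  assumes "\<And>n. n \<in> posnats \<Longrightarrow> f n \<ge> 0"
  shows "f summable_on posnats \<longleftrightarrow> summable (\<lambda>n. f (Suc n))"
proof -
  have "posnats = range Suc"
    using Suc_le_D by fastforce
  then have "f summable_on posnats \<longleftrightarrow> (\<lambda>n. f (Suc n)) summable_on UNIV"
    by (simp add: summable_on_reindex o_def)
  also have "\<dots> \<longleftrightarrow> summable (\<lambda>n. f (Suc n))"
    using assms by (intro summable_on_UNIV_nonneg_real_iff) auto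
  finally show ?thesis .
qed

text \<open>A finite \<open>F\<close> would belong to the ideal together with its complement, and so
  would their union \<open>posnats\<close>. This ensures that \<open>enumerate F\<close> really
  lists \<open>F\<close>.\<close>

lemma infinite_dual_filter:
  assumes "ideal_on_posnats I" "F \<in> dual_filter I"
  shows "infinite F"
proof
  assume "finite F"
  obtain A where A: "A \<in> I" "F = posnats - A"
    using assms(2) unfolding dual_filter_def by blast
  have "F \<in> I"
    using assms(1) \<open>finite F\<close> A(2) by (simp add: ideal_on_posnats_def)
  then have "A \<union> F \<in> I"
    using assms(1) A(1) by (simp add: ideal_on_posnats_def)
  moreover have "A \<subseteq> posnats"
    using assms(1) A(1) by (auto simp: ideal_on_posnats_def)
  then have "A \<union> F = posnats"
    using A(2) by blast
  ultimately show False
    using assms(1) by (simp add: ideal_on_posnats_def)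
qed

text \<open>An index with deviation at least \<epsilon> lies either outside \<open>F\<close>, hence
  in a member of \<open>I\<close>, or among finitely many initial elements of
  \<open>F\<close>.\<close>

lemma ideal_star_lim_imp_ideal_lim:
  assumes I: "ideal_on_posnats I" and lim: "ideal_star_lim I x L"
  shows "ideal_lim I x L"
  unfolding ideal_lim_def
proof (intro allI impI)
  fix \<epsilon> :: real assume "\<epsilon> > 0"
  obtain F where F: "F \<in> dual_filter I" and Flim: "(\<lambda>k. x (enumerate F k)) \<longlonglongrightarrow> L"
    using lim unfolding ideal_star_lim_def by blast
  obtain A where A: "A \<in> I" "F = posnats - A"
    using F unfolding dual_filter_def by blast
  obtain N where N: "\<bar>x (enumerate F k) - L\<bar> < \<epsilon>" if "k \<ge> N" for k
    using LIMSEQ_D[OF Flim \<open>\<epsilon> > 0\<close>] by auto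
  let ?B = "enumerate F ` {..<N} \<inter> posnats"
  have "{n \<in> posnats. \<bar>x n - L\<bar> \<ge> \<epsilon>} \<subseteq> A \<union> ?B"
  proof
    fix n assume n: "n \<in> {n \<in> posnats. \<bar>x n - L\<bar> \<ge> \<epsilon>}"
    show "n \<in> A \<union> ?B"
    proof (cases "n \<in> A")
      case False
      with n A have "n \<in> F" by auto
      then obtain k where k: "enumerate F k = n"
        using enumerate_Ex infinite_dual_filter[OF I F] by metis
      with n N[of k] have "k < N" by (cases "k \<ge> N") auto
      with k n show ?thesis by auto
    qed simp
  qed
  moreover have "?B \<in> I"
    using I by (simp add: ideal_on_posnats_def)
  then have "A \<union> ?B \<in> I"
    using I A(1) by (simp add: ideal_on_posnats_def)
  ultimately show "{n \<in> posnats. \<bar>x n - L\<bar> \<ge> \<epsilon>} \<in> I"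
    using I unfolding ideal_on_posnats_def by blast
qed

lemma ideal_star_lim_of_summable_ideal_subset:
  fixes g :: "real \<Rightarrow> real" and a b c :: "nat \<Rightarrow> real"
  assumes I: "ideal_on_posnats I"
    and gpos: "g \<in> {0<..} \<rightarrow> {0<..}"
    and gmono: "strict_mono_on {0<..} g"
    and gbound: "\<forall>\<epsilon>>0. \<exists>M. \<forall>x>0. g x / g (\<epsilon> * x) \<le> M"
    and bpos: "\<forall>n\<in>posnats. b n > 0"
    and cpos: "\<forall>n\<in>posnats. c n > 0"
    and sub: "summable_ideal (\<lambda>n. b n * g (1 / c n)) \<subseteq> I"
    and ran: "\<forall>n\<in>posnats. a n \<in> g ` {0<..}"
    and sm: "summable (\<lambda>n. b (Suc n) * a (Suc n))"
  shows "ideal_star_lim I (\<lambda>n. c n * inv_into {0<..} g (a n)) 0"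
proof -
  define y where "y n = c n * inv_into {0<..} g (a n)" for n
  have gp: "g x > 0" if "x > 0" for x using gpos that by auto
  have inv: "inv_into {0<..} g (a n) > 0" "g (inv_into {0<..} g (a n)) = a n" if "n \<in> posnats" for n
    using ran that inv_into_into[of "a n" g "{0<..}"] f_inv_into_f[of "a n" g "{0<..}"] by auto
  have ypos: "y n > 0" and ga: "g (y n / c n) = a n" and apos: "a n > 0" if n: "n \<in> posnats" for n
  proof -
    have "c n > 0" using cpos n by blast
    then show "y n > 0" "g (y n / c n) = a n" "a n > 0"
      using inv[OF n] gp[OF inv(1)[OF n]] by (simp_all add: y_def)
  qed
  have ppos: "b (Suc n) * a (Suc n) > 0" for n
    using bpos apos by simp
  then obtain t where tpos: "\<And>n. t n > (0::real)" and ttop: "filterlim t at_top sequentially"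
    and tsm: "summable (\<lambda>n. t n * (b (Suc n) * a (Suc n)))"
    using summable_diverging_weights[OF ppos sm] by blast
  \<comment> \<open>The weights are indexed from 0 and the sequences from 1, hence
    \<open>t (n - 1)\<close>. No \<epsilon> enters \<open>A\<close>, so a single filter set
    \<open>F\<close> serves every \<epsilon>, as the star limit demands.\<close>
  define A where "A = {n \<in> posnats. g (1 / c n) \<le> t (n - 1) * a n}"
  have "t (n - 1) * (b n * a n) \<ge> 0" if "n \<in> posnats" for n
    using tpos[of "n - 1"] apos[OF that] bpos[rule_format, OF that] by simp
  then have "(\<lambda>n. t (n - 1) * (b n * a n)) summable_on posnats"
    using tsm by (subst summable_on_posnats_iff) simp_all
  then have "(\<lambda>n. t (n - 1) * (b n * a n)) summable_on A"
    by (rule summable_on_subset_banach) (auto simp: A_def)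
  then have "(\<lambda>n. b n * g (1 / c n)) summable_on A"
  proof (rule summable_on_comparison_test)
    fix n assume n: "n \<in> A"
    then have "b n > 0" "c n > 0" "g (1 / c n) \<le> t (n - 1) * a n"
      using bpos cpos by (auto simp: A_def)
    then show "b n * g (1 / c n) \<le> t (n - 1) * (b n * a n)" "0 \<le> b n * g (1 / c n)"
      using mult_left_mono[of "g (1 / c n)" "t (n - 1) * a n" "b n"] gp[of "1 / c n"]
      by (auto simp: algebra_simps)
  qed
  moreover have "A \<subseteq> posnats"
    by (auto simp: A_def)
  ultimately have "A \<in> summable_ideal (\<lambda>n. b n * g (1 / c n))"
    by (simp add: summable_ideal_def)
  with sub have "A \<in> I" by (rule subsetD)
  define F where "F = posnats - A"
  have F: "F \<in> dual_filter I"
    using \<open>A \<in> I\<close> unfolding F_def dual_filter_def by blast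
  have infF: "infinite F" by (rule infinite_dual_filter[OF I F])
  have enF: "enumerate F k \<in> F" for k by (rule enumerate_in_set[OF infF])
  have "\<forall>\<^sub>F k in sequentially. \<bar>y (enumerate F k)\<bar> < \<epsilon>" if eps: "\<epsilon> > 0" for \<epsilon>
  proof -
    obtain M where M: "\<And>x. x > 0 \<Longrightarrow> g x / g (\<epsilon> * x) \<le> M"
      using gbound eps by blast
    obtain N where N: "\<And>n. n \<ge> N \<Longrightarrow> M \<le> t n"
      using ttop unfolding filterlim_at_top eventually_sequentially by blast
    \<comment> \<open>If \<open>y n \<ge> \<epsilon>\<close>, monotonicity and the growth bound at
      \<open>1 / c n\<close> give \<open>g (1 / c n) \<le> M * g (\<epsilon> / c n) \<le> t (n - 1)
      * a n\<close>, which puts \<open>n\<close> in \<open>A\<close>. The strict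
      \<open>n > N\<close> yields \<open>n - 1 \<ge> N\<close>.\<close>
    have small: "y n < \<epsilon>" if n: "n \<in> F" "n > N" for n
    proof (rule ccontr)
      assume "\<not> y n < \<epsilon>"
      have n': "n \<in> posnats" and lt: "t (n - 1) * a n < g (1 / c n)"
        using n by (auto simp: F_def A_def)
      then have c: "c n > 0" using cpos by blast
      have "\<epsilon> / c n \<le> y n / c n"
        using \<open>\<not> y n < \<epsilon>\<close> c by (simp add: divide_right_mono)
      then have "g (\<epsilon> / c n) \<le> a n"
        using strict_mono_on_leD[OF gmono, of "\<epsilon> / c n" "y n / c n"] ga[OF n'] ypos[OF n'] c \<open>\<epsilon> > 0\<close>
        by simp
      moreover have "g (1 / c n) \<le> M * g (\<epsilon> / c n)"
        using M[of "1 / c n"] gp[of "\<epsilon> / c n"] c \<open>\<epsilon> > 0\<close> by (simp add: pos_divide_le_eq)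
      moreover have "M \<le> t (n - 1)" using N n by simp
      then have "M * g (\<epsilon> / c n) \<le> t (n - 1) * g (\<epsilon> / c n)"
        using gp[of "\<epsilon> / c n"] c \<open>\<epsilon> > 0\<close> by (intro mult_right_mono) auto
      moreover have "t (n - 1) * g (\<epsilon> / c n) \<le> t (n - 1) * a n"
        using \<open>g (\<epsilon> / c n) \<le> a n\<close> tpos[of "n - 1"] by simp
      ultimately show False using lt by linarith
    qed
    \<comment> \<open>Since \<open>k \<le> enumerate F k\<close>, the threshold on elements of
      \<open>F\<close> is also one on positions.\<close>
    have "\<bar>y (enumerate F k)\<bar> < \<epsilon>" if "k > N" for k
      using small[OF enF, of k] ypos[of "enumerate F k"] enF[of k] that le_enumerate[OF infF, of k]
      by (auto simp: F_def)
    then show ?thesis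
      by (rule eventually_mono[OF eventually_gt_at_top])
  qed
  then have "(\<lambda>k. y (enumerate F k)) \<longlonglongrightarrow> 0"
    by (simp add: tendsto_iff dist_real_def)
  with F show ?thesis
    unfolding ideal_star_lim_def y_def by blast
qed

lemma summable_ideal_subset_of_ideal_lim:
  fixes g :: "real \<Rightarrow> real" and b c :: "nat \<Rightarrow> real"
  assumes I: "ideal_on_posnats I"
    and gpos: "g \<in> {0<..} \<rightarrow> {0<..}"
    and gmono: "strict_mono_on {0<..} g"
    and glim: "(g \<longlongrightarrow> 0) (at_right 0)"
    and bpos: "\<forall>n\<in>posnats. b n > 0"
    and cpos: "\<forall>n\<in>posnats. c n > 0"
    and lim: "\<And>a. \<forall>n\<in>posnats. a n \<in> g ` {0<..} \<Longrightarrow> summable (\<lambda>n. b (Suc n) * a (Suc n)) \<Longrightarrow>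
      ideal_lim I (\<lambda>n. c n * inv_into {0<..} g (a n)) 0"
  shows "summable_ideal (\<lambda>n. b n * g (1 / c n)) \<subseteq> I"
proof
  fix A assume "A \<in> summable_ideal (\<lambda>n. b n * g (1 / c n))"
  then have A: "A \<subseteq> posnats" and smA: "(\<lambda>n. b n * g (1 / c n)) summable_on A"
    by (auto simp: summable_ideal_def)
  have gp: "g x > 0" if "x > 0" for x using gpos that by auto
  \<comment> \<open>The limit of \<open>g\<close> at 0 provides values in its range below
    \<open>(1/2) ^ n / b n\<close>.\<close>
  have "\<exists>x>0. b n * g x \<le> (1/2) ^ n" if "n \<in> posnats" for n
  proof -
    have b: "b n > 0" using bpos that by blast
    then have "\<forall>\<^sub>F x in at_right 0. g x < (1/2) ^ n / b n"
      by (intro order_tendstoD(2)[OF glim]) simp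
    then have "\<forall>\<^sub>F x in at_right 0. x > 0 \<and> g x < (1/2) ^ n / b n"
      using eventually_at_right_less by (rule eventually_conj[rotated])
    then obtain x where "x > 0" "g x < (1/2) ^ n / b n"
      using eventually_happens'[OF trivial_limit_at_right_real] by blast
    then show ?thesis using b by (auto simp: field_simps intro!: exI[of _ x])
  qed
  then obtain z where z: "\<And>n. n \<in> posnats \<Longrightarrow> z n > 0 \<and> b n * g (z n) \<le> (1/2) ^ n"
    by metis
  \<comment> \<open>The test sequence is \<open>g (x n)\<close>. On \<open>A\<close> it makes
    \<open>c n * x n\<close> equal to 1, so \<open>A\<close> lies in the exceptional set for
    \<epsilon> = 1; off \<open>A\<close> only summability matters.\<close>
  define x where "x n = (if n \<in> A then 1 / c n else z n)" for n
  have xpos: "x n > 0" if "n \<in> posnats" for n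
    using that cpos z by (auto simp: x_def)
  have nonneg: "b n * g (x n) \<ge> 0" if "n \<in> posnats" for n
    using bpos gp[OF xpos[OF that]] that by (auto intro: less_imp_le)
  have "(\<lambda>n. b n * g (x n)) summable_on A"
    using smA by (rule summable_on_cong[THEN iffD1, rotated]) (simp add: x_def)
  moreover have "(\<lambda>n. (1/2::real) ^ n) summable_on posnats"
    by (subst summable_on_posnats_iff) (auto intro!: summable_mult summable_geometric)
  then have "(\<lambda>n. (1/2::real) ^ n) summable_on (posnats - A)"
    by (rule summable_on_subset_banach) auto
  then have "(\<lambda>n. b n * g (x n)) summable_on (posnats - A)"
  proof (rule summable_on_comparison_test)
    fix n assume n: "n \<in> posnats - A"
    then show "b n * g (x n) \<le> (1/2) ^ n"
      using z[of n] by (simp add: x_def)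
    show "0 \<le> b n * g (x n)"
      using n nonneg by blast
  qed
  ultimately have "(\<lambda>n. b n * g (x n)) summable_on (A \<union> (posnats - A))"
    by (rule summable_on_Un_disjoint) auto
  moreover have "A \<union> (posnats - A) = posnats" using A by auto
  ultimately have "summable (\<lambda>n. b (Suc n) * g (x (Suc n)))"
    using summable_on_posnats_iff[of "\<lambda>n. b n * g (x n)"] nonneg by simp
  then have "ideal_lim I (\<lambda>n. c n * inv_into {0<..} g (g (x n))) 0"
    using xpos by (intro lim) auto
  then have in_I: "{n \<in> posnats. \<bar>c n * inv_into {0<..} g (g (x n)) - 0\<bar> \<ge> 1} \<in> I"
    unfolding ideal_lim_def by (metis zero_less_one)
  have "A \<subseteq> {n \<in> posnats. \<bar>c n * inv_into {0<..} g (g (x n)) - 0\<bar> \<ge> 1}"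
  proof
    fix n assume n: "n \<in> A"
    with A have "n \<in> posnats" by blast
    moreover from this have "inv_into {0<..} g (g (x n)) = x n"
      using xpos by (intro inv_into_f_f strict_mono_on_imp_inj_on[OF gmono]) auto
    moreover have "c n > 0" using \<open>n \<in> posnats\<close> cpos by blast
    ultimately show "n \<in> {n \<in> posnats. \<bar>c n * inv_into {0<..} g (g (x n)) - 0\<bar> \<ge> 1}"
      using n by (simp add: x_def)
  qed
  with in_I I show "A \<in> I" unfolding ideal_on_posnats_def by blast
qed

theorem theorem2p2:
  fixes I :: "nat set set" and g :: "real \<Rightarrow> real" and b c :: "nat \<Rightarrow> real"
  assumes "ideal_on_posnats I"
    and "g \<in> {0<..} \<rightarrow> {0<..}"
    and "strict_mono_on {0<..} g"
    and "(g \<longlongrightarrow> 0) (at_right 0)"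
    and "\<forall>\<epsilon>>0. \<exists>M. \<forall>x>0. g x / g (\<epsilon> * x) \<le> M"
    and "\<forall>n\<in>posnats. b n > 0"
    and "\<forall>n\<in>posnats. c n > 0"
  defines "cond1 \<equiv> \<forall>a :: nat \<Rightarrow> real. (\<forall>n\<in>posnats. a n \<in> g ` {0<..}) \<longrightarrow>
      summable (\<lambda>n. b (Suc n) * a (Suc n)) \<longrightarrow>
      ideal_star_lim I (\<lambda>n. c n * inv_into {0<..} g (a n)) 0"
    and "cond2 \<equiv> \<forall>a :: nat \<Rightarrow> real. (\<forall>n\<in>posnats. a n \<in> g ` {0<..}) \<longrightarrow>
      summable (\<lambda>n. b (Suc n) * a (Suc n)) \<longrightarrow>
      ideal_lim I (\<lambda>n. c n * inv_into {0<..} g (a n)) 0"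
    and "cond3 \<equiv> summable_ideal (\<lambda>n. b n * g (1 / c n)) \<subseteq> I"
  shows "(cond1 \<longleftrightarrow> cond2) \<and> (cond2 \<longleftrightarrow> cond3)"
proof -
  have "cond1 \<Longrightarrow> cond2"
    unfolding cond1_def cond2_def using ideal_star_lim_imp_ideal_lim[OF assms(1)] by blast
  moreover have "cond2 \<Longrightarrow> cond3"
    unfolding cond2_def cond3_def
    by (rule summable_ideal_subset_of_ideal_lim[OF assms(1-4,6,7)]) blast+
  moreover have "cond3 \<Longrightarrow> cond1"
    unfolding cond1_def cond3_def
    using ideal_star_lim_of_summable_ideal_subset[OF assms(1-3,5-7)] by blast
  ultimately show ?thesis by blast
qed

end
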